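(* Let $q\ge 1$, $\varphi>0$, let $x,y\ge 0$ be real numbers that are not both $0$, and let $w=(w_1,\dots,w_n)^T$ be a weight vector with $w_i\in[0,1]$ and $\sum_{i=1}^n w_i=1$. Let $a_i=\langle[u_i^-,u_i^+],[v_i^-,v_i^+]\rangle$ and $a_i'=\langle[u_i^{-\prime},u_i^{+\prime}],[v_i^{-\prime},v_i^{+\prime}]\rangle$ ($i=1,\dots,n$) be two families of interval valued $q$-rung orthopair fuzzy numbers such that, for all $i$, $u_i^-\le u_i^{-\prime}$, $u_i^+\le u_i^{+\prime}$, $v_i^-\ge v_i^{-\prime}$, $v_i^+\ge v_i^{+\prime}$. Then $$\mathrm{IVq\text{-}ROFHHMWA}_w^{x,y}(a_1,\dots,a_n)\le \mathrm{IVq\text{-}ROFHHMWA}_w^{x,y}(a_1',\dots,a_n').$$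
   Context: Fix a real $q\ge 1$ and a parameter $\varphi>0$. An interval valued $q$-rung orthopair fuzzy number (IVq-ROFN) is a pair $a=\langle[u^-,u^+],[v^-,v^+]\rangle$ of closed subintervals of $[0,1]$ with $(u^+)^q+(v^+)^q\le 1$. Order: the score of $a$ is $S(a)=\frac12\left(u^--v^+(1-u^+)+u^+-v^-(1-u^-)\right)$ and its exact value is $H(a)=\frac12\left[(u^-)^q+(u^+)^q+(v^-)^q+(v^+)^q\right]$. One writes $a_1<a_2$ if $S(a_1)<S(a_2)$, or if $S(a_1)=S(a_2)$ and $H(a_1)<H(a_2)$; $a_1$ and $a_2$ are regarded as equal in the order if $S(a_1)=S(a_2)$ and $H(a_1)=H(a_2)$. Here $a_1\le a_2$ means that $a_1<a_2$ or $a_1,a_2$ are equal in this sense. For real $s,t\in[0,1]$ put $$T(s,t)=\frac{st}{\sqrt[q]{\varphi+(1-\varphi)(s^q+t^q-s^qt^q)}},\qquad C(s,t)=\sqrt[q]{\frac{s^q+t^q-s^qt^q-(1-\varphi)s^qt^q}{1-(1-\varphi)s^qt^q}},$$ and for $\vartheta\ge 0$ (with $0^0=1$) $$M_\vartheta(s)=\sqrt[q]{\frac{(1+(\varphi-1)s^q)^\vartheta-(1-s^q)^\vartheta}{(1+(\varphi-1)s^q)^\vartheta+(\varphi-1)(1-s^q)^\vartheta}},\qquad P_\vartheta(s)=\frac{\sqrt[q]{\varphi}\,s^\vartheta}{\sqrt[q]{(1+(\varphi-1)(1-s^q))^\vartheta+(\varphi-1)(s^q)^\vartheta}}.$$ The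 Hamacher operations on IVq-ROFNs $a_k=\langle[u_k^-,u_k^+],[v_k^-,v_k^+]\rangle$ are $$a_1\oplus_H a_2=\langle[C(u_1^-,u_2^-),C(u_1^+,u_2^+)],[T(v_1^-,v_2^-),T(v_1^+,v_2^+)]\rangle,$$ $$a_1\otimes_H a_2=\langle[T(u_1^-,u_2^-),T(u_1^+,u_2^+)],[C(v_1^-,v_2^-),C(v_1^+,v_2^+)]\rangle,$$ $$\vartheta a=\langle[M_\vartheta(u^-),M_\vartheta(u^+)],[P_\vartheta(v^-),P_\vartheta(v^+)]\rangle,\qquad a^\vartheta=\langle[P_\vartheta(u^-),P_\vartheta(u^+)],[M_\vartheta(v^-),M_\vartheta(v^+)]\rangle.$$ The operator is $$\mathrm{IVq\text{-}ROFHHMWA}_w^{x,y}(a_1,\dots,a_n)=\frac{1}{x+y}\left(\bigotimes_{\substack{H\\ i=1,\,j=1}}^{n}\left(x a_i^{w_i}\oplus_H y a_j^{w_j}\right)^{\frac{2}{n(n+1)}}\right),$$ where the $\otimes_H$-product runs over all pairs $(i,j)$ with $1\le i,j\le n$ and $x a_i^{w_i}$ means $x(a_i^{w_i})$. *)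

theory Defs
  imports Complex_Main
begin

text \<open>A pair of intervals is stored by its endpoints \<open>\<langle>[ulo, uhi], [vlo, vhi]\<rangle>\<close>; the constraints
  that make it an interval valued \<open>q\<close>-rung orthopair fuzzy number are in \<open>is_ivqrofn\<close>.\<close>

datatype ivqrofn = IVQ (ulo: real) (uhi: real) (vlo: real) (vhi: real)

definition is_ivqrofn :: "real \<Rightarrow> ivqrofn \<Rightarrow> bool" where
  "is_ivqrofn q a \<longleftrightarrow>
     0 \<le> ulo a \<and> ulo a \<le> uhi a \<and> uhi a \<le> 1 \<and>
     0 \<le> vlo a \<and> vlo a \<le> vhi a \<and> vhi a \<le> 1 \<and>
     uhi a powr q + vhi a powr q \<le> 1"

definition score :: "ivqrofn \<Rightarrow> real" where
  "score a = 1/2 * (ulo a - vhi a * (1 - uhi a) + uhi a - vlo a * (1 - ulo a))"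

definition exact_value :: "real \<Rightarrow> ivqrofn \<Rightarrow> real" where
  "exact_value q a = 1/2 * (ulo a powr q + uhi a powr q + vlo a powr q + vhi a powr q)"

definition ivq_less :: "real \<Rightarrow> ivqrofn \<Rightarrow> ivqrofn \<Rightarrow> bool" where
  "ivq_less q a b \<longleftrightarrow>
     score a < score b \<or> (score a = score b \<and> exact_value q a < exact_value q b)"

definition ivq_equiv :: "real \<Rightarrow> ivqrofn \<Rightarrow> ivqrofn \<Rightarrow> bool" where
  "ivq_equiv q a b \<longleftrightarrow> score a = score b \<and> exact_value q a = exact_value q b"

definition ivq_le :: "real \<Rightarrow> ivqrofn \<Rightarrow> ivqrofn \<Rightarrow> bool" where
  "ivq_le q a b \<longleftrightarrow> ivq_less q a b \<or> ivq_equiv q a b"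

text \<open>The library has \<open>0 powr 0 = 0\<close>. The exponents \<open>\<theta>\<close> below may be \<open>0\<close> and use the convention
  \<open>0\<^sup>0 = 1\<close>, hence \<open>rpow\<close>; for the positive exponents \<open>q\<close> and \<open>1/q\<close> plain \<open>powr\<close> is right.
  \<open>qroot q x\<close> is only used for \<open>x \<ge> 0\<close>.\<close>

definition rpow :: "real \<Rightarrow> real \<Rightarrow> real" where
  "rpow s \<theta> = (if \<theta> = 0 then 1 else s powr \<theta>)"

definition qroot :: "real \<Rightarrow> real \<Rightarrow> real" where
  "qroot q x = x powr (1 / q)"

definition ham_T :: "real \<Rightarrow> real \<Rightarrow> real \<Rightarrow> real \<Rightarrow> real" where
  "ham_T q \<phi> s t =
     s * t / qroot q (\<phi> + (1 - \<phi>) * (s powr q + t powr q - s powr q * t powr q))"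

definition ham_C :: "real \<Rightarrow> real \<Rightarrow> real \<Rightarrow> real \<Rightarrow> real" where
  "ham_C q \<phi> s t =
     qroot q ((s powr q + t powr q - s powr q * t powr q - (1 - \<phi>) * (s powr q * t powr q))
              / (1 - (1 - \<phi>) * (s powr q * t powr q)))"

definition ham_M :: "real \<Rightarrow> real \<Rightarrow> real \<Rightarrow> real \<Rightarrow> real" where
  "ham_M q \<phi> \<theta> s =
     qroot q ((rpow (1 + (\<phi> - 1) * s powr q) \<theta> - rpow (1 - s powr q) \<theta>)
              / (rpow (1 + (\<phi> - 1) * s powr q) \<theta> + (\<phi> - 1) * rpow (1 - s powr q) \<theta>))"

definition ham_P :: "real \<Rightarrow> real \<Rightarrow> real \<Rightarrow> real \<Rightarrow> real" where
  "ham_P q \<phi> \<theta> s =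
     qroot q \<phi> * rpow s \<theta>
       / qroot q (rpow (1 + (\<phi> - 1) * (1 - s powr q)) \<theta> + (\<phi> - 1) * rpow (s powr q) \<theta>)"

definition ham_add :: "real \<Rightarrow> real \<Rightarrow> ivqrofn \<Rightarrow> ivqrofn \<Rightarrow> ivqrofn" where
  "ham_add q \<phi> a b =
     IVQ (ham_C q \<phi> (ulo a) (ulo b)) (ham_C q \<phi> (uhi a) (uhi b))
         (ham_T q \<phi> (vlo a) (vlo b)) (ham_T q \<phi> (vhi a) (vhi b))"

definition ham_mult :: "real \<Rightarrow> real \<Rightarrow> ivqrofn \<Rightarrow> ivqrofn \<Rightarrow> ivqrofn" where
  "ham_mult q \<phi> a b =
     IVQ (ham_T q \<phi> (ulo a) (ulo b)) (ham_T q \<phi> (uhi a) (uhi b))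
         (ham_C q \<phi> (vlo a) (vlo b)) (ham_C q \<phi> (vhi a) (vhi b))"

definition ham_scale :: "real \<Rightarrow> real \<Rightarrow> real \<Rightarrow> ivqrofn \<Rightarrow> ivqrofn" where
  "ham_scale q \<phi> \<theta> a =
     IVQ (ham_M q \<phi> \<theta> (ulo a)) (ham_M q \<phi> \<theta> (uhi a))
         (ham_P q \<phi> \<theta> (vlo a)) (ham_P q \<phi> \<theta> (vhi a))"

definition ham_power :: "real \<Rightarrow> real \<Rightarrow> ivqrofn \<Rightarrow> real \<Rightarrow> ivqrofn" where
  "ham_power q \<phi> a \<theta> =
     IVQ (ham_P q \<phi> \<theta> (ulo a)) (ham_P q \<phi> \<theta> (uhi a))
         (ham_M q \<phi> \<theta> (vlo a)) (ham_M q \<phi> \<theta> (vhi a))"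

text \<open>The product of a list. \<open>\<langle>[1,1],[0,0]\<rangle>\<close> is the neutral element of \<open>ham_mult\<close>; it is the
  value only for the empty list, which does not occur for \<open>n \<ge> 1\<close>.\<close>

fun ham_prod :: "real \<Rightarrow> real \<Rightarrow> ivqrofn list \<Rightarrow> ivqrofn" where
  "ham_prod q \<phi> [] = IVQ 1 1 0 0"
| "ham_prod q \<phi> [a] = a"
| "ham_prod q \<phi> (a # b # as) = ham_mult q \<phi> a (ham_prod q \<phi> (b # as))"

text \<open>The family is \<open>a 1, \<dots>, a n\<close>. The pairs \<open>(i, j)\<close> are multiplied in lexicographic order,
  which is immaterial because \<open>ham_mult\<close> is commutative and associative on the numbers
  satisfying \<open>is_ivqrofn\<close>.\<close>

definition ivqrofhhmwa ::
  "real \<Rightarrow> real \<Rightarrow> real \<Rightarrow> real \<Rightarrow> nat \<Rightarrow> (nat \<Rightarrow> real) \<Rightarrow> (nat \<Rightarrow> ivqrofn) \<Rightarrow> ivqrofn" where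
  "ivqrofhhmwa q \<phi> x y n w a =
     ham_scale q \<phi> (1 / (x + y))
       (ham_prod q \<phi>
         (map (\<lambda>(i, j).
                 ham_power q \<phi>
                   (ham_add q \<phi> (ham_scale q \<phi> x (ham_power q \<phi> (a i) (w i)))
                                (ham_scale q \<phi> y (ham_power q \<phi> (a j) (w j))))
                   (2 / (real n * (real n + 1))))
           (List.product [1..<Suc n] [1..<Suc n])))"

end

theory Submission
  imports Defs
begin

text \<open>
  The reason for the theorem is that every Hamacher operation is monotone for the componentwise
  order (larger membership degrees, smaller non-membership degrees), and that the order by score
  and exact value extends the componentwise order.

  Monotonicity becomes transparent after the substitution \<open>\<sigma> = s\<^sup>q\<close>, which removes all roots:
  \<open>T\<close> and \<open>P\<^sub>\<theta>\<close> turn into functions \<open>T_core\<close> and \<open>P_core\<close> that increase on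
  \<open>[0,1]\<close>, while \<open>C\<close> and \<open>M\<^sub>\<theta>\<close> turn into their de Morgan duals \<open>1 - F (1 - \<sigma>) (1 - \<tau>)\<close>.
  So \<open>\<otimes>\<close> and the powers have one common form, \<open>dual_pair\<close>, built from a single increasing
  function \<open>F\<close>, and \<open>\<oplus>\<close> and the scalar multiples are conjugate to them under exchange of
  membership and non-membership. That \<open>F\<close> is increasing gives both facts needed about
  such an operation: it respects the componentwise order (\<open>dual_pair_mono\<close>), and it preserves
  \<open>u\<^sup>q + v\<^sup>q \<le> 1\<close>, because \<open>\<sigma> \<le> 1 - \<sigma>'\<close> and \<open>\<tau> \<le> 1 - \<tau>'\<close> imply
  \<open>F \<sigma> \<tau> \<le> F (1 - \<sigma>') (1 - \<tau>')\<close> (\<open>dual_pair_closed\<close>).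

  Closure is more than a side condition. The score increases strictly in the membership degrees,
  but it does not depend on a non-membership degree whose membership partner is \<open>1\<close>. It is the
  constraint \<open>u\<^sup>q + v\<^sup>q \<le> 1\<close> that forces the non-membership degree to be \<open>0\<close> there, so that
  comparable numbers of equal score are identical (\<open>dominated_imp_ivq_le\<close>).
\<close>

section \<open>The operations after the substitution of q-th powers\<close>

definition unit_mono :: "(real \<Rightarrow> real \<Rightarrow> real) \<Rightarrow> bool" where
  "unit_mono F \<longleftrightarrow>
     (\<forall>\<sigma> \<tau>. 0 \<le> \<sigma> \<longrightarrow> \<sigma> \<le> 1 \<longrightarrow> 0 \<le> \<tau> \<longrightarrow> \<tau> \<le> 1 \<longrightarrow> 0 \<le> F \<sigma> \<tau> \<and> F \<sigma> \<tau> \<le> 1) \<and>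
     (\<forall>\<sigma> \<sigma>' \<tau> \<tau>'. 0 \<le> \<sigma> \<longrightarrow> \<sigma> \<le> \<sigma>' \<longrightarrow> \<sigma>' \<le> 1 \<longrightarrow> 0 \<le> \<tau> \<longrightarrow> \<tau> \<le> \<tau>' \<longrightarrow> \<tau>' \<le> 1 \<longrightarrow>
        F \<sigma> \<tau> \<le> F \<sigma>' \<tau>')"

lemma unit_monoI:
  assumes "\<And>\<sigma> \<tau>. \<lbrakk>0 \<le> \<sigma>; \<sigma> \<le> 1; 0 \<le> \<tau>; \<tau> \<le> 1\<rbrakk> \<Longrightarrow> 0 \<le> F \<sigma> \<tau>"
    and "F 1 1 \<le> 1"
    and "\<And>\<sigma> \<sigma>' \<tau> \<tau>'. \<lbrakk>0 \<le> \<sigma>; \<sigma> \<le> \<sigma>'; \<sigma>' \<le> 1; 0 \<le> \<tau>; \<tau> \<le> \<tau>'; \<tau>' \<le> 1\<rbrakk> \<Longrightarrow> F \<sigma> \<tau> \<le> F \<sigma>' \<tau>'"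
  shows "unit_mono F"
proof -
  have "F \<sigma> \<tau> \<le> 1" if "0 \<le> \<sigma>" "\<sigma> \<le> 1" "0 \<le> \<tau>" "\<tau> \<le> 1" for \<sigma> \<tau>
    using assms(3)[of \<sigma> 1 \<tau> 1] assms(2) that by linarith
  then show ?thesis
    unfolding unit_mono_def using assms by blast
qed

text \<open>The \<open>q\<close>-th power of \<open>T(s, t)\<close> in the variables \<open>\<sigma> = s\<^sup>q\<close>, \<open>\<tau> = t\<^sup>q\<close>: the Hamacher
  t-norm with parameter \<open>\<phi>\<close>. Likewise, \<open>P_core\<close> is the \<open>q\<close>-th power of \<open>P\<^sub>\<theta>(s)\<close>.\<close>

definition T_core :: "real \<Rightarrow> real \<Rightarrow> real \<Rightarrow> real" where
  "T_core \<phi> \<sigma> \<tau> = \<sigma> * \<tau> / (\<phi> + (1 - \<phi>) * (\<sigma> + \<tau> - \<sigma> * \<tau>))"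

definition P_core :: "real \<Rightarrow> real \<Rightarrow> real \<Rightarrow> real" where
  "P_core \<phi> \<theta> \<sigma> =
     \<phi> * rpow \<sigma> \<theta> / (rpow (1 + (\<phi> - 1) * (1 - \<sigma>)) \<theta> + (\<phi> - 1) * rpow \<sigma> \<theta>)"

text \<open>A convex combination of \<open>\<phi>\<close> and \<open>1\<close>. The denominator of \<open>T_core\<close> has this form, and so has
  the base \<open>1 + (\<phi> - 1) * (1 - \<sigma>)\<close> of the power in \<open>P_core\<close>.\<close>

lemma convex_denominator_pos:
  fixes \<phi> \<rho> :: real
  assumes "\<phi> > 0" "0 \<le> \<rho>" "\<rho> \<le> 1"
  shows "\<phi> + (1 - \<phi>) * \<rho> > 0"
proof -
  have "\<phi> + (1 - \<phi>) * \<rho> = \<phi> * (1 - \<rho>) + \<rho>" by (simp add: algebra_simps)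
  moreover have "\<phi> * (1 - \<rho>) + \<rho> > 0"
    using assms by (cases "\<rho> = 0") (auto intro: add_nonneg_pos)
  ultimately show ?thesis by simp
qed

lemma prob_sum_unit:
  fixes \<sigma> \<tau> :: real
  assumes "0 \<le> \<sigma>" "\<sigma> \<le> 1" "0 \<le> \<tau>" "\<tau> \<le> 1"
  shows "0 \<le> \<sigma> + \<tau> - \<sigma> * \<tau>" "\<sigma> + \<tau> - \<sigma> * \<tau> \<le> 1"
proof -
  have "\<sigma> + \<tau> - \<sigma> * \<tau> = \<sigma> + \<tau> * (1 - \<sigma>)" by (simp add: algebra_simps)
  moreover have "0 \<le> \<sigma> + \<tau> * (1 - \<sigma>)" using assms by simp
  ultimately show "0 \<le> \<sigma> + \<tau> - \<sigma> * \<tau>" by simp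
  have "0 \<le> (1 - \<sigma>) * (1 - \<tau>)" using assms by simp
  then show "\<sigma> + \<tau> - \<sigma> * \<tau> \<le> 1" by (simp add: algebra_simps)
qed

lemma T_core_denominator_pos:
  fixes \<phi> \<sigma> \<tau> :: real
  assumes "\<phi> > 0" "0 \<le> \<sigma>" "\<sigma> \<le> 1" "0 \<le> \<tau>" "\<tau> \<le> 1"
  shows "\<phi> + (1 - \<phi>) * (\<sigma> + \<tau> - \<sigma> * \<tau>) > 0"
  using assms by (intro convex_denominator_pos prob_sum_unit)

lemma T_core_commute: "T_core \<phi> \<sigma> \<tau> = T_core \<phi> \<tau> \<sigma>"
  by (simp add: T_core_def mult.commute add.commute)

lemma T_core_mono_left:
  assumes "\<phi> > 0" "0 \<le> \<sigma>" "\<sigma> \<le> \<sigma>'" "\<sigma>' \<le> 1" "0 \<le> \<tau>" "\<tau> \<le> 1"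
  shows "T_core \<phi> \<sigma> \<tau> \<le> T_core \<phi> \<sigma>' \<tau>"
proof -
  let ?D = "\<lambda>\<rho>. \<phi> + (1 - \<phi>) * (\<rho> + \<tau> - \<rho> * \<tau>)"
  have pos: "?D \<sigma> > 0" "?D \<sigma>' > 0"
    using assms by (auto intro!: T_core_denominator_pos)
  \<comment> \<open>The terms with \<open>\<sigma> * \<sigma>'\<close> cancel in the cross product.\<close>
  have "\<sigma>' * \<tau> * ?D \<sigma> - \<sigma> * \<tau> * ?D \<sigma>' = \<tau> * (\<sigma>' - \<sigma>) * (\<phi> + (1 - \<phi>) * \<tau>)"
    by (simp add: algebra_simps)
  moreover have "0 \<le> \<tau> * (\<sigma>' - \<sigma>) * (\<phi> + (1 - \<phi>) * \<tau>)"
    using assms convex_denominator_pos[of \<phi> \<tau>] by simp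
  ultimately have "\<sigma> * \<tau> * ?D \<sigma>' \<le> \<sigma>' * \<tau> * ?D \<sigma>" by linarith
  then show ?thesis
    unfolding T_core_def using pos by (simp add: frac_le_eq divide_le_eq pos_le_divide_eq)
qed

lemma T_core_unit_mono:
  assumes "\<phi> > 0"
  shows "unit_mono (T_core \<phi>)"
proof (rule unit_monoI)
  fix \<sigma> \<tau> :: real
  assume "0 \<le> \<sigma>" "\<sigma> \<le> 1" "0 \<le> \<tau>" "\<tau> \<le> 1"
  then show "0 \<le> T_core \<phi> \<sigma> \<tau>"
    using T_core_denominator_pos[OF assms] unfolding T_core_def
    by (intro divide_nonneg_pos) auto
next
  show "T_core \<phi> 1 1 \<le> 1" by (simp add: T_core_def)
next
  fix \<sigma> \<sigma>' \<tau> \<tau>' :: real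
  assume "0 \<le> \<sigma>" "\<sigma> \<le> \<sigma>'" "\<sigma>' \<le> 1" "0 \<le> \<tau>" "\<tau> \<le> \<tau>'" "\<tau>' \<le> 1"
  then have "T_core \<phi> \<sigma> \<tau> \<le> T_core \<phi> \<sigma>' \<tau>" "T_core \<phi> \<tau> \<sigma>' \<le> T_core \<phi> \<tau>' \<sigma>'"
    using assms by (auto intro!: T_core_mono_left)
  then show "T_core \<phi> \<sigma> \<tau> \<le> T_core \<phi> \<sigma>' \<tau>'"
    by (metis T_core_commute order.trans)
qed

lemma rpow_nonneg: "0 \<le> rpow s \<theta>"
  by (simp add: rpow_def)

lemma rpow_pos: "s > 0 \<Longrightarrow> 0 < rpow s \<theta>"
  by (simp add: rpow_def)

lemma rpow_mono: "\<lbrakk>0 \<le> \<theta>; 0 \<le> s; s \<le> t\<rbrakk> \<Longrightarrow> rpow s \<theta> \<le> rpow t \<theta>"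
  by (simp add: rpow_def powr_mono2)

lemma rpow_mult: "\<lbrakk>0 \<le> s; 0 \<le> t\<rbrakk> \<Longrightarrow> rpow (s * t) \<theta> = rpow s \<theta> * rpow t \<theta>"
  by (simp add: rpow_def powr_mult)

text \<open>With \<open>A = 1 + (\<phi> - 1) * (1 - \<sigma>)\<close> the denominator is
  \<open>(A\<^sup>\<theta> - \<sigma>\<^sup>\<theta>) + \<phi> * \<sigma>\<^sup>\<theta>\<close>, where \<open>A \<ge> \<sigma>\<close> and \<open>A > 0\<close>.\<close>

lemma P_core_denominator_pos:
  fixes \<phi> \<theta> \<sigma> :: real
  assumes "\<phi> > 0" "0 \<le> \<theta>" "0 \<le> \<sigma>" "\<sigma> \<le> 1"
  shows "rpow (1 + (\<phi> - 1) * (1 - \<sigma>)) \<theta> + (\<phi> - 1) * rpow \<sigma> \<theta> > 0"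
proof -
  let ?A = "1 + (\<phi> - 1) * (1 - \<sigma>)"
  have A: "?A = \<phi> + (1 - \<phi>) * \<sigma>" "?A = \<sigma> + \<phi> * (1 - \<sigma>)" by (simp_all add: algebra_simps)
  have A_pos: "?A > 0" unfolding A(1) using assms by (intro convex_denominator_pos)
  have "\<sigma> \<le> ?A" unfolding A(2) using assms by simp
  then have le: "rpow \<sigma> \<theta> \<le> rpow ?A \<theta>" using assms by (intro rpow_mono)
  have "rpow ?A \<theta> - rpow \<sigma> \<theta> + \<phi> * rpow \<sigma> \<theta> > 0"
  proof (cases "rpow \<sigma> \<theta> = 0")
    case True
    then show ?thesis using rpow_pos[OF A_pos] by simp
  next
    case False
    then have "0 < \<phi> * rpow \<sigma> \<theta>" using assms rpow_nonneg[of \<sigma> \<theta>] by simp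
    then show ?thesis using le by linarith
  qed
  then show ?thesis by (simp add: algebra_simps)
qed

text \<open>With \<open>A\<close> as above and \<open>\<sigma> > 0\<close>, the value is \<open>\<phi> / ((A / \<sigma>)\<^sup>\<theta> + \<phi> - 1)\<close>, and
  \<open>A / \<sigma> = \<phi> / \<sigma> + 1 - \<phi>\<close> decreases in \<open>\<sigma>\<close>. The proof uses the cross-multiplied
  form, which also covers \<open>\<sigma> = 0\<close>.\<close>

lemma P_core_unit_mono:
  assumes "\<phi> > 0" "0 \<le> \<theta>"
  shows "unit_mono (\<lambda>\<sigma> \<tau>. P_core \<phi> \<theta> \<sigma>)"
proof (rule unit_monoI)
  fix \<sigma> :: real
  assume "0 \<le> \<sigma>" "\<sigma> \<le> 1"
  then show "0 \<le> P_core \<phi> \<theta> \<sigma>"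
    unfolding P_core_def using P_core_denominator_pos[OF assms] assms rpow_nonneg
    by (intro divide_nonneg_pos) auto
next
  show "P_core \<phi> \<theta> 1 \<le> 1" using assms by (simp add: P_core_def rpow_def)
next
  fix \<sigma> \<sigma>' :: real
  assume le: "0 \<le> \<sigma>" "\<sigma> \<le> \<sigma>'" "\<sigma>' \<le> 1"
  let ?A = "\<lambda>\<rho>. 1 + (\<phi> - 1) * (1 - \<rho>)"
  let ?D = "\<lambda>\<rho>. rpow (?A \<rho>) \<theta> + (\<phi> - 1) * rpow \<rho> \<theta>"
  have pos: "?D \<sigma> > 0" "?D \<sigma>' > 0"
    using le assms by (auto intro!: P_core_denominator_pos)
  have A_nonneg: "?A \<rho> \<ge> 0" if "0 \<le> \<rho>" "\<rho> \<le> 1" for \<rho>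
    using convex_denominator_pos[OF assms(1) that] by (simp add: algebra_simps)
  have "\<sigma>' * ?A \<sigma> - \<sigma> * ?A \<sigma>' = \<phi> * (\<sigma>' - \<sigma>)" by (simp add: algebra_simps)
  moreover have "0 \<le> \<phi> * (\<sigma>' - \<sigma>)" using le assms by simp
  ultimately have "\<sigma> * ?A \<sigma>' \<le> \<sigma>' * ?A \<sigma>" by linarith
  then have "rpow (\<sigma> * ?A \<sigma>') \<theta> \<le> rpow (\<sigma>' * ?A \<sigma>) \<theta>"
    using le assms A_nonneg[of \<sigma>'] by (intro rpow_mono) auto
  then have "rpow \<sigma> \<theta> * rpow (?A \<sigma>') \<theta> \<le> rpow \<sigma>' \<theta> * rpow (?A \<sigma>) \<theta>"
    using le A_nonneg[of \<sigma>] A_nonneg[of \<sigma>'] by (simp add: rpow_mult)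
  then have "rpow \<sigma> \<theta> * ?D \<sigma>' \<le> rpow \<sigma>' \<theta> * ?D \<sigma>"
    unfolding distrib_left by (simp add: mult.left_commute mult.commute)
  then have "rpow \<sigma> \<theta> / ?D \<sigma> \<le> rpow \<sigma>' \<theta> / ?D \<sigma>'"
    using pos by (simp add: divide_le_eq pos_le_divide_eq)
  then have "\<phi> * (rpow \<sigma> \<theta> / ?D \<sigma>) \<le> \<phi> * (rpow \<sigma>' \<theta> / ?D \<sigma>')"
    using assms by (intro mult_left_mono) auto
  then show "P_core \<phi> \<theta> \<sigma> \<le> P_core \<phi> \<theta> \<sigma>'"
    unfolding P_core_def by simp
qed

section \<open>Returning to the original variables\<close>

lemma qroot_nonneg: "0 \<le> qroot q x"
  by (simp add: qroot_def)

lemma qroot_mono: "\<lbrakk>q \<ge> 1; 0 \<le> s; s \<le> t\<rbrakk> \<Longrightarrow> qroot q s \<le> qroot q t"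
  by (simp add: qroot_def powr_mono2)

lemma qroot_le_1: "\<lbrakk>q \<ge> 1; 0 \<le> s; s \<le> 1\<rbrakk> \<Longrightarrow> qroot q s \<le> 1"
  using qroot_mono[of q s 1] by (simp add: qroot_def)

lemma qroot_powr_q: "\<lbrakk>q \<ge> 1; 0 \<le> s\<rbrakk> \<Longrightarrow> qroot q s powr q = s"
  by (simp add: qroot_def powr_powr)

lemma qroot_of_powr_q: "\<lbrakk>q \<ge> 1; 0 \<le> s\<rbrakk> \<Longrightarrow> qroot q (s powr q) = s"
  by (simp add: qroot_def powr_powr)

lemma qroot_mult: "\<lbrakk>0 \<le> s; 0 \<le> t\<rbrakk> \<Longrightarrow> qroot q (s * t) = qroot q s * qroot q t"
  by (simp add: qroot_def powr_mult)

lemma qroot_divide: "\<lbrakk>0 \<le> s; 0 \<le> t\<rbrakk> \<Longrightarrow> qroot q (s / t) = qroot q s / qroot q t"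
  by (simp add: qroot_def powr_divide)

lemma powr_unit: "\<lbrakk>q \<ge> 1; 0 \<le> s; s \<le> (1::real)\<rbrakk> \<Longrightarrow> s powr q \<le> 1"
  using powr_mono2[of q s 1] by simp

lemma ham_T_eq:
  assumes "q \<ge> 1" "\<phi> > 0" "0 \<le> s" "s \<le> 1" "0 \<le> t" "t \<le> 1"
  shows "ham_T q \<phi> s t = qroot q (T_core \<phi> (s powr q) (t powr q))"
proof -
  have "\<phi> + (1 - \<phi>) * (s powr q + t powr q - s powr q * t powr q) > 0"
    using assms by (intro T_core_denominator_pos) (auto intro: powr_unit)
  then show ?thesis
    using assms by (simp add: ham_T_def T_core_def qroot_divide qroot_mult qroot_of_powr_q)
qed

lemma ham_C_eq:
  assumes "q \<ge> 1" "\<phi> > 0" "0 \<le> s" "s \<le> 1" "0 \<le> t" "t \<le> 1"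
  shows "ham_C q \<phi> s t = qroot q (1 - T_core \<phi> (1 - s powr q) (1 - t powr q))"
proof -
  let ?\<sigma> = "s powr q" and ?\<tau> = "t powr q"
  let ?D = "\<phi> + (1 - \<phi>) * ((1 - ?\<sigma>) + (1 - ?\<tau>) - (1 - ?\<sigma>) * (1 - ?\<tau>))"
  have "?D > 0"
    using assms by (intro T_core_denominator_pos) (auto intro: powr_unit)
  moreover have D: "?D = 1 - (1 - \<phi>) * (?\<sigma> * ?\<tau>)" by (simp add: algebra_simps)
  ultimately have "(?\<sigma> + ?\<tau> - ?\<sigma> * ?\<tau> - (1 - \<phi>) * (?\<sigma> * ?\<tau>)) / (1 - (1 - \<phi>) * (?\<sigma> * ?\<tau>))
      = 1 - T_core \<phi> (1 - ?\<sigma>) (1 - ?\<tau>)"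
    unfolding T_core_def D by (simp add: diff_eq_eq add_divide_distrib[symmetric] divide_eq_eq algebra_simps)
  then show ?thesis by (simp only: ham_C_def)
qed

lemma ham_P_eq:
  assumes "q \<ge> 1" "\<phi> > 0" "0 \<le> \<theta>" "0 \<le> s" "s \<le> 1"
  shows "ham_P q \<phi> \<theta> s = qroot q (P_core \<phi> \<theta> (s powr q))"
proof -
  have "rpow (1 + (\<phi> - 1) * (1 - s powr q)) \<theta> + (\<phi> - 1) * rpow (s powr q) \<theta> > 0"
    using assms by (intro P_core_denominator_pos) (auto intro: powr_unit)
  moreover have "qroot q (rpow (s powr q) \<theta>) = rpow s \<theta>"
    using assms by (simp add: qroot_def rpow_def powr_powr)
  ultimately show ?thesis
    using assms rpow_nonneg[of "s powr q" \<theta>]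
    by (simp add: ham_P_def P_core_def qroot_divide qroot_mult)
qed

lemma ham_M_eq:
  assumes "q \<ge> 1" "\<phi> > 0" "0 \<le> \<theta>" "0 \<le> s" "s \<le> 1"
  shows "ham_M q \<phi> \<theta> s = qroot q (1 - P_core \<phi> \<theta> (1 - s powr q))"
proof -
  let ?A = "rpow (1 + (\<phi> - 1) * s powr q) \<theta>" and ?B = "rpow (1 - s powr q) \<theta>"
  have "?A + (\<phi> - 1) * ?B > 0"
    using P_core_denominator_pos[of \<phi> \<theta> "1 - s powr q"] assms powr_unit[of q s] by simp
  then have "(?A - ?B) / (?A + (\<phi> - 1) * ?B) = 1 - P_core \<phi> \<theta> (1 - s powr q)"
    unfolding P_core_def by (simp add: divide_simps) (simp add: algebra_simps)
  then show ?thesis by (simp only: ham_M_def)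
qed

section \<open>Closure and monotonicity for the componentwise order\<close>

text \<open>The componentwise order. It includes validity of both sides, so that one
  monotonicity statement for an operation also carries its closure.\<close>

definition dominated :: "real \<Rightarrow> ivqrofn \<Rightarrow> ivqrofn \<Rightarrow> bool" where
  "dominated q a b \<longleftrightarrow> is_ivqrofn q a \<and> is_ivqrofn q b \<and>
     ulo a \<le> ulo b \<and> uhi a \<le> uhi b \<and> vlo b \<le> vlo a \<and> vhi b \<le> vhi a"

text \<open>The common form of \<open>\<otimes>\<close> (with \<open>F = T_core \<phi>\<close>) and of the power \<open>a\<^sup>\<theta>\<close>
  (with \<open>b = a\<close> and an \<open>F\<close> that ignores its second argument).\<close>

definition dual_pair :: "real \<Rightarrow> (real \<Rightarrow> real \<Rightarrow> real) \<Rightarrow> ivqrofn \<Rightarrow> ivqrofn \<Rightarrow> ivqrofn" where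
  "dual_pair q F a b =
     (let N = \<lambda>s t. qroot q (F (s powr q) (t powr q));
          N' = \<lambda>s t. qroot q (1 - F (1 - s powr q) (1 - t powr q))
      in IVQ (N (ulo a) (ulo b)) (N (uhi a) (uhi b)) (N' (vlo a) (vlo b)) (N' (vhi a) (vhi b)))"

lemma dual_pair_closed:
  assumes q: "q \<ge> 1" and F: "unit_mono F" and a: "is_ivqrofn q a" and b: "is_ivqrofn q b"
  shows "is_ivqrofn q (dual_pair q F a b)"
proof -
  have unit: "0 \<le> F \<sigma> \<tau>" "F \<sigma> \<tau> \<le> 1" if "0 \<le> \<sigma>" "\<sigma> \<le> 1" "0 \<le> \<tau>" "\<tau> \<le> 1" for \<sigma> \<tau>
    using F that unfolding unit_mono_def by blast+
  have mono: "F \<sigma> \<tau> \<le> F \<sigma>' \<tau>'"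
    if "0 \<le> \<sigma>" "\<sigma> \<le> \<sigma>'" "\<sigma>' \<le> 1" "0 \<le> \<tau>" "\<tau> \<le> \<tau>'" "\<tau>' \<le> 1" for \<sigma> \<sigma>' \<tau> \<tau>'
    using F that unfolding unit_mono_def by blast
  have pw: "ulo c powr q \<le> uhi c powr q" "vlo c powr q \<le> vhi c powr q"
      "uhi c powr q \<le> 1" "vhi c powr q \<le> 1" "vlo c powr q \<le> 1" "ulo c powr q \<le> 1"
      "uhi c powr q \<le> 1 - vhi c powr q"
    if "is_ivqrofn q c" for c
    using that q unfolding is_ivqrofn_def by (auto intro!: powr_mono2 powr_unit)
  note pa = pw[OF a] and pb = pw[OF b]
  let ?u = "F (uhi a powr q) (uhi b powr q)" and ?v = "F (1 - vhi a powr q) (1 - vhi b powr q)"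
  \<comment> \<open>The orthopair constraint: each \<open>u\<^sup>q\<close> is at most \<open>1 - v\<^sup>q\<close>, and \<open>F\<close> is increasing.\<close>
  have "?u \<le> ?v" using pa pb by (intro mono) auto
  moreover have "0 \<le> ?u" "?u \<le> 1" "0 \<le> 1 - ?v" "1 - ?v \<le> 1"
    using pa pb by (auto intro!: unit)
  moreover have "F (ulo a powr q) (ulo b powr q) \<le> ?u" "0 \<le> F (ulo a powr q) (ulo b powr q)"
    using pa pb by (auto intro!: mono unit)
  moreover have "1 - F (1 - vlo a powr q) (1 - vlo b powr q) \<le> 1 - ?v"
      "0 \<le> 1 - F (1 - vlo a powr q) (1 - vlo b powr q)"
    using pa pb by (auto intro!: mono unit)
  ultimately show ?thesis
    using q unfolding is_ivqrofn_def dual_pair_def Let_def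
    by (auto simp: qroot_powr_q intro!: qroot_nonneg qroot_mono qroot_le_1)
qed

lemma dual_pair_mono:
  assumes q: "q \<ge> 1" and F: "unit_mono F" and "dominated q a a'" "dominated q b b'"
  shows "dominated q (dual_pair q F a b) (dual_pair q F a' b')"
proof -
  have unit: "0 \<le> F \<sigma> \<tau>" "F \<sigma> \<tau> \<le> 1" if "0 \<le> \<sigma>" "\<sigma> \<le> 1" "0 \<le> \<tau>" "\<tau> \<le> 1" for \<sigma> \<tau>
    using F that unfolding unit_mono_def by blast+
  have mono: "F \<sigma> \<tau> \<le> F \<sigma>' \<tau>'"
    if "0 \<le> \<sigma>" "\<sigma> \<le> \<sigma>'" "\<sigma>' \<le> 1" "0 \<le> \<tau>" "\<tau> \<le> \<tau>'" "\<tau>' \<le> 1" for \<sigma> \<sigma>' \<tau> \<tau>'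
    using F that unfolding unit_mono_def by blast
  have N: "qroot q (F (s powr q) (t powr q)) \<le> qroot q (F (s' powr q) (t' powr q))"
    and N': "qroot q (1 - F (1 - s powr q) (1 - t powr q))
        \<le> qroot q (1 - F (1 - s' powr q) (1 - t' powr q))"
    if "0 \<le> s" "s \<le> s'" "s' \<le> 1" "0 \<le> t" "t \<le> t'" "t' \<le> 1" for s t s' t'
  proof -
    have "s powr q \<le> s' powr q" "t powr q \<le> t' powr q" "s' powr q \<le> 1" "t' powr q \<le> 1"
      using q that by (auto intro!: powr_mono2 powr_unit)
    then show "qroot q (F (s powr q) (t powr q)) \<le> qroot q (F (s' powr q) (t' powr q))"
      and "qroot q (1 - F (1 - s powr q) (1 - t powr q))
        \<le> qroot q (1 - F (1 - s' powr q) (1 - t' powr q))"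
      using q by (auto intro!: qroot_mono mono unit)
  qed
  have "is_ivqrofn q (dual_pair q F a b)" "is_ivqrofn q (dual_pair q F a' b')"
    using assms by (auto simp: dominated_def intro!: dual_pair_closed)
  then show ?thesis
    using assms(3,4) unfolding dominated_def dual_pair_def Let_def is_ivqrofn_def
    by (auto intro!: N N')
qed

text \<open>Exchanging the two intervals reverses the componentwise order and turns \<open>\<otimes>\<close> and
  powers into \<open>\<oplus>\<close> and scalar multiples.\<close>

definition complement :: "ivqrofn \<Rightarrow> ivqrofn" where
  "complement a = IVQ (vlo a) (vhi a) (ulo a) (uhi a)"

lemma is_ivqrofn_complement [simp]: "is_ivqrofn q (complement a) \<longleftrightarrow> is_ivqrofn q a"
  by (auto simp: is_ivqrofn_def complement_def add.commute)

lemma dominated_complement [simp]: "dominated q (complement a) (complement b) \<longleftrightarrow> dominated q b a"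
  unfolding dominated_def is_ivqrofn_complement by (auto simp: complement_def)

context
  fixes q \<phi> :: real
  assumes q: "q \<ge> 1" and \<phi>: "\<phi> > 0"
begin

lemma ham_mult_eq:
  "\<lbrakk>is_ivqrofn q a; is_ivqrofn q b\<rbrakk> \<Longrightarrow> ham_mult q \<phi> a b = dual_pair q (T_core \<phi>) a b"
  using q \<phi> by (simp add: ham_mult_def dual_pair_def is_ivqrofn_def ham_T_eq ham_C_eq)

lemma ham_power_eq:
  "\<lbrakk>0 \<le> \<theta>; is_ivqrofn q a\<rbrakk> \<Longrightarrow> ham_power q \<phi> a \<theta> = dual_pair q (\<lambda>\<sigma> \<tau>. P_core \<phi> \<theta> \<sigma>) a a"
  using q \<phi> by (simp add: ham_power_def dual_pair_def is_ivqrofn_def ham_P_eq ham_M_eq)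

lemma ham_add_eq_complement: "ham_add q \<phi> a b = complement (ham_mult q \<phi> (complement a) (complement b))"
  by (simp add: ham_add_def ham_mult_def complement_def)

lemma ham_scale_eq_complement: "ham_scale q \<phi> \<theta> a = complement (ham_power q \<phi> (complement a) \<theta>)"
  by (simp add: ham_scale_def ham_power_def complement_def)

lemma ham_mult_mono:
  assumes "dominated q a a'" "dominated q b b'"
  shows "dominated q (ham_mult q \<phi> a b) (ham_mult q \<phi> a' b')"
  using dual_pair_mono[OF q T_core_unit_mono[OF \<phi>] assms] assms
  by (simp add: dominated_def ham_mult_eq)

lemma ham_power_mono:
  assumes "0 \<le> \<theta>" "dominated q a a'"
  shows "dominated q (ham_power q \<phi> a \<theta>) (ham_power q \<phi> a' \<theta>)"
  using dual_pair_mono[OF q P_core_unit_mono[OF \<phi> assms(1)] assms(2) assms(2)] assms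
  by (simp add: dominated_def ham_power_eq)

lemma ham_add_mono:
  "\<lbrakk>dominated q a a'; dominated q b b'\<rbrakk> \<Longrightarrow> dominated q (ham_add q \<phi> a b) (ham_add q \<phi> a' b')"
  by (simp add: ham_add_eq_complement ham_mult_mono)

lemma ham_scale_mono:
  "\<lbrakk>0 \<le> \<theta>; dominated q a a'\<rbrakk> \<Longrightarrow> dominated q (ham_scale q \<phi> \<theta> a) (ham_scale q \<phi> \<theta> a')"
  by (simp add: ham_scale_eq_complement ham_power_mono)

lemma ham_prod_mono:
  "list_all2 (dominated q) as bs \<Longrightarrow> dominated q (ham_prod q \<phi> as) (ham_prod q \<phi> bs)"
proof (induction as bs rule: list_all2_induct)
  case Nil
  then show ?case by (simp add: dominated_def is_ivqrofn_def)
next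
  case (Cons a as b bs)
  then show ?case
    by (cases as; cases bs) (auto intro: ham_mult_mono)
qed

end

section \<open>From the componentwise order to the order by score\<close>

text \<open>The score difference splits into four nonnegative terms. If they all vanish, the
  membership degrees agree, and a non-membership degree can differ only where its factor \<open>1 - u\<close> is \<open>0\<close>; but \<open>u = 1\<close> forces \<open>v = 0\<close> on both sides.\<close>

lemma dominated_imp_ivq_le:
  assumes q: "q \<ge> 1" and ab: "dominated q a b"
  shows "ivq_le q a b"
proof -
  have va: "is_ivqrofn q a" and vb: "is_ivqrofn q b"
    and le: "ulo a \<le> ulo b" "uhi a \<le> uhi b" "vlo b \<le> vlo a" "vhi b \<le> vhi a"
    using ab by (auto simp: dominated_def)
  have gain: "2 * (score b - score a) =
      (ulo b - ulo a) * (1 + vlo b) + (uhi b - uhi a) * (1 + vhi b)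
      + (vlo a - vlo b) * (1 - ulo a) + (vhi a - vhi b) * (1 - uhi a)"
    by (simp add: score_def field_simps)
  have nonneg: "0 \<le> (ulo b - ulo a) * (1 + vlo b)" "0 \<le> (uhi b - uhi a) * (1 + vhi b)"
      "0 \<le> (vlo a - vlo b) * (1 - ulo a)" "0 \<le> (vhi a - vhi b) * (1 - uhi a)"
    using va vb le by (auto simp: is_ivqrofn_def)
  show ?thesis
  proof (cases "score a < score b")
    case True
    then show ?thesis by (simp add: ivq_le_def ivq_less_def)
  next
    case False
    have sum_zero: "p = 0 \<and> r = 0 \<and> s = 0 \<and> t = 0"
      if "0 \<le> p" "0 \<le> r" "0 \<le> s" "0 \<le> t" "p + r + s + t \<le> 0" for p r s t :: real
      using that by linarith
    have zero: "(ulo b - ulo a) * (1 + vlo b) = 0" "(uhi b - uhi a) * (1 + vhi b) = 0"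
        "(vlo a - vlo b) * (1 - ulo a) = 0" "(vhi a - vhi b) * (1 - uhi a) = 0"
      using sum_zero[OF nonneg] gain False by simp_all
    have uhi_1: "vhi a = 0 \<and> vlo a = 0" if "uhi a = 1"
      using va that q by (auto simp: is_ivqrofn_def)
    have "1 + vlo b > 0" "1 + vhi b > 0" using vb by (auto simp: is_ivqrofn_def)
    then have "ulo a = ulo b" "uhi a = uhi b" using zero by auto
    moreover have "vhi a = vhi b"
      using zero(4) uhi_1 le vb by (auto simp: is_ivqrofn_def)
    moreover have "vlo a = vlo b"
    proof (cases "ulo a = 1")
      case True
      then have "uhi a = 1" using va by (auto simp: is_ivqrofn_def)
      then show ?thesis using uhi_1 le vb by (auto simp: is_ivqrofn_def)
    qed (use zero(3) in auto)
    ultimately have "a = b" by (simp add: ivqrofn.expand)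
    then show ?thesis by (simp add: ivq_le_def ivq_equiv_def)
  qed
qed

theorem theorem8:
  fixes q \<phi> x y :: real and n :: nat and w :: "nat \<Rightarrow> real" and a a' :: "nat \<Rightarrow> ivqrofn"
  assumes "q \<ge> 1" and "\<phi> > 0"
    and "x \<ge> 0" and "y \<ge> 0" and "\<not> (x = 0 \<and> y = 0)"
    and "\<And>i. i \<in> {1..n} \<Longrightarrow> 0 \<le> w i \<and> w i \<le> 1"
    and "(\<Sum>i=1..n. w i) = 1"
    and "\<And>i. i \<in> {1..n} \<Longrightarrow> is_ivqrofn q (a i)"
    and "\<And>i. i \<in> {1..n} \<Longrightarrow> is_ivqrofn q (a' i)"
    and "\<And>i. i \<in> {1..n} \<Longrightarrow> ulo (a i) \<le> ulo (a' i)"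
    and "\<And>i. i \<in> {1..n} \<Longrightarrow> uhi (a i) \<le> uhi (a' i)"
    and "\<And>i. i \<in> {1..n} \<Longrightarrow> vlo (a i) \<ge> vlo (a' i)"
    and "\<And>i. i \<in> {1..n} \<Longrightarrow> vhi (a i) \<ge> vhi (a' i)"
  shows "ivq_le q (ivqrofhhmwa q \<phi> x y n w a) (ivqrofhhmwa q \<phi> x y n w a')"
proof -
  have dom: "dominated q (a i) (a' i)" and w: "0 \<le> w i" if "1 \<le> i" "i < Suc n" for i
    using assms(6,8-) that by (auto simp: dominated_def)
  have "dominated q (ivqrofhhmwa q \<phi> x y n w a) (ivqrofhhmwa q \<phi> x y n w a')"
    unfolding ivqrofhhmwa_def using assms(1-4)
    by (intro ham_scale_mono ham_prod_mono)
       (auto simp: list_all2_map1 list_all2_map2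
             intro!: list.rel_refl_strong ham_scale_mono ham_power_mono ham_add_mono dom w)
  then show ?thesis using assms(1) by (rule dominated_imp_ivq_le[rotated])
qed

end
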